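(* Let $L,T>0$, and let $0<h<\underline{H}<H$ be mesh sizes of nested meshes of $\Sigma$ such that the associated piecewise constant boundary element spaces satisfy $\mathcal{S}_H^0(\Sigma)\subset\mathcal{S}_{\underline H}^0(\Sigma)\subset\mathcal{S}_h^0(\Sigma)$. Assume that there exists a constant $\widetilde c_S(n)>0$ such that $$\widetilde c_S(n)\,\|v_{\underline H}\|_{[H^1_{,0}(\Sigma)]'}\le\sup_{0\neq q_h\in\mathcal{S}_h^0(\Sigma)}\frac{\langle\mathsf{V}v_{\underline H},q_h\rangle_{L^2(\Sigma)}}{\|q_h\|_{L^2(\Sigma)}}\qquad\text{for all }v_{\underline H}\in\mathcal{S}_{\underline H}^0(\Sigma).$$ Let $g\in L^2(\Sigma)$ and let $w\in[H^1_{,0}(\Sigma)]'$ be the unique solution of $\mathsf{V}w=g$. Let $(p_h,w_H)\in\mathcal{S}_h^0(\Sigma)\times\mathcal{S}_H^0(\Sigma)$ be the unique solution of $$\langle p_h,q_h\rangle_{L^2(\Sigma)}+\langle\mathsf{V}w_H,q_h\rangle_{L^2(\Sigma)}=\langle g,q_h\rangle_{L^2(\Sigma)},\qquad\langle p_h,\mathsf{V}v_H\rangle_{L^2(\Sigma)}=0$$ for all $q_h\in\mathcal{S}_h^0(\Sigma)$, $v_H\in\mathcal{S}_H^0(\Sigma)$, and let $(\overline p_h,w_{\underline H})\in\mathcal{S}_h^0(\Sigma)\times\mathcal{S}_{\underline H}^0(\Sigma)$ be the unique solution of $$\langle\overline p_h,q_h\rangle_{L^2(\Sigma)}+\langle\mathsf{V}w_{\underline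 H},q_h\rangle_{L^2(\Sigma)}=\langle g,q_h\rangle_{L^2(\Sigma)},\qquad\langle\overline p_h,\mathsf{V}v_{\underline H}\rangle_{L^2(\Sigma)}=0$$ for all $q_h\in\mathcal{S}_h^0(\Sigma)$, $v_{\underline H}\in\mathcal{S}_{\underline H}^0(\Sigma)$. If the saturation assumption $$\|w-w_{\underline H}\|_{[H^1_{,0}(\Sigma)]'}\le\delta\,\|w-w_H\|_{[H^1_{,0}(\Sigma)]'}\quad\text{for some }\delta\in(0,1)$$ holds, then $$\frac{1}{c_2^{\mathsf{V}}}\,\|p_h\|_{L^2(\Sigma)}\le\|w-w_H\|_{[H^1_{,0}(\Sigma)]'}\le\frac{c_2^{\mathsf{V}}}{[\widetilde c_S(n)]^2}\,\frac{1}{1-\delta}\,\|p_h\|_{L^2(\Sigma)}.$$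
   Context: All functions are real-valued. $L^2(\Sigma) := L^2(0,T)\times L^2(0,T)$ and $H^1_{,0}(\Sigma) := H^1_{,0}(0,T)\times H^1_{,0}(0,T)$, where $H^1_{,0}(0,T)=\{q\in H^1(0,T): q(T)=0\}$; elements are written $u=(u_0,u_L)$, with $\|u\|^2_{L^2(\Sigma)} = \|u_0\|^2_{L^2(0,T)}+\|u_L\|^2_{L^2(0,T)}$ and $\|u\|^2_{H^1_{,0}(\Sigma)} := \|\partial_t u_0\|^2_{L^2(0,T)}+\|\partial_t u_L\|^2_{L^2(0,T)}$. $[H^1_{,0}(\Sigma)]'$ is the dual of $H^1_{,0}(\Sigma)$ with respect to $L^2(\Sigma)$ (the pairing $\langle\cdot,\cdot\rangle_\Sigma$ extends the $L^2(\Sigma)$ inner product, so $L^2(\Sigma)\subset [H^1_{,0}(\Sigma)]'$), with norm $\|w\|_{[H^1_{,0}(\Sigma)]'} = \sup_{0\neq v\in H^1_{,0}(\Sigma)}\langle w,v\rangle_\Sigma/\|v\|_{H^1_{,0}(\Sigma)}$. The single layer boundary integral operator of the wave equation on $(0,L)\times(0,T)$ is, for $w=(w_0,w_L)\in L^2(\Sigma)$ and $t\in(0,T)$, $$(\mathsf{V}w)(t) = \begin{pmatrix} \frac12\int_0^t w_0(s)\,ds + \frac12\int_0^{t-L} w_L(s)\,ds\\[1mm] \frac12\int_0^{t-L} w_0(s)\,ds+\frac12\int_0^t w_L(s)\,ds\end{pmatrix},$$ where integrals $\int_0^{t-L}$ are understood as $0$ for $t\le L$. $\mathsf{V}:[H^1_{,0}(\Sigma)]'\to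 L^2(\Sigma)$ denotes its continuous extension, which is an isomorphism; $c_2^{\mathsf{V}}>0$ denotes its boundedness constant, i.e. $\|\mathsf{V}v\|_{L^2(\Sigma)}\le c_2^{\mathsf{V}}\|v\|_{[H^1_{,0}(\Sigma)]'}$ for all $v\in[H^1_{,0}(\Sigma)]'$. Here $n=\min\{m\in\mathbb{N}:T\le mL\}$ is the number of time slices, and $\widetilde c_S(n)$ is just the name of the assumed discrete inf-sup constant. A mesh of $\Sigma$ consists of a decomposition of $(0,T)$ into finitely many intervals (elements) for the component at $x=0$ and another decomposition of $(0,T)$ for the component at $x=L$. $\mathcal{S}_H^0(\Sigma)$, $\mathcal{S}_{\underline H}^0(\Sigma)$ and $\mathcal{S}_h^0(\Sigma)$ are the spaces of functions in $L^2(\Sigma)$ that are piecewise constant with respect to the meshes of mesh size $H$, $\underline H$ and $h$, respectively. *)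

theory Defs
  imports "HOL-Analysis.Analysis" "HOL-Library.Function_Algebras"
begin

text \<open>
  Elements of \<open>L\<^sup>2(0,T)\<close> are represented by functions rather than by classes of functions; equality
  of classes is \<open>eqS\<close> below. A function on \<open>\<Sigma>\<close> is the pair of its components at \<open>x = 0\<close> and \<open>x = L\<close>.
\<close>

type_synonym bfun = "(real \<Rightarrow> real) \<times> (real \<Rightarrow> real)"
type_synonym functional = "bfun \<Rightarrow> real"

definition scaleS :: "real \<Rightarrow> bfun \<Rightarrow> bfun" where
  "scaleS c u = (\<lambda>t. c * fst u t, \<lambda>t. c * snd u t)"

definition L2 :: "real \<Rightarrow> (real \<Rightarrow> real) set" where
  "L2 T = {f. f \<in> borel_measurable (lebesgue_on {0<..<T}) \<and>
              integrable (lebesgue_on {0<..<T}) (\<lambda>t. (f t)\<^sup>2)}"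

definition L2_inner :: "real \<Rightarrow> (real \<Rightarrow> real) \<Rightarrow> (real \<Rightarrow> real) \<Rightarrow> real" where
  "L2_inner T f g = (LINT t|lebesgue_on {0<..<T}. f t * g t)"

definition L2S :: "real \<Rightarrow> bfun set" where
  "L2S T = L2 T \<times> L2 T"

definition innerS :: "real \<Rightarrow> bfun \<Rightarrow> bfun \<Rightarrow> real" where
  "innerS T u v = L2_inner T (fst u) (fst v) + L2_inner T (snd u) (snd v)"

definition normS :: "real \<Rightarrow> bfun \<Rightarrow> real" where
  "normS T u = sqrt (L2_inner T (fst u) (fst u) + L2_inner T (snd u) (snd u))"

definition eqS :: "real \<Rightarrow> bfun \<Rightarrow> bfun \<Rightarrow> bool" where
  "eqS T u v \<longleftrightarrow> (AE t in lebesgue_on {0<..<T}. fst u t = fst v t) \<and>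
                 (AE t in lebesgue_on {0<..<T}. snd u t = snd v t)"

text \<open>
  Weak derivatives are tested against \<open>C\<^sup>1\<close> functions with compact support in \<open>(0,T)\<close>, extended by
  zero to the real line (the convention of Brezis for Sobolev spaces on an interval; smooth test
  functions give the same space and the same derivative).
\<close>

definition test_functions :: "real \<Rightarrow> (real \<Rightarrow> real) set" where
  "test_functions T = {\<phi>. \<phi> C1_differentiable_on UNIV \<and>
     (\<exists>K. compact K \<and> K \<subseteq> {0<..<T} \<and> (\<forall>t. t \<notin> K \<longrightarrow> \<phi> t = 0))}"

definition has_weak_derivative :: "real \<Rightarrow> (real \<Rightarrow> real) \<Rightarrow> (real \<Rightarrow> real) \<Rightarrow> bool" where
  "has_weak_derivative T q r \<longleftrightarrow>
     (\<forall>\<phi>\<in>test_functions T. L2_inner T q (deriv \<phi>) = - L2_inner T r \<phi>)"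

definition H1 :: "real \<Rightarrow> (real \<Rightarrow> real) set" where
  "H1 T = {q \<in> L2 T. \<exists>r\<in>L2 T. has_weak_derivative T q r}"

text \<open>The choice is unique up to equality almost everywhere.\<close>

definition weak_deriv :: "real \<Rightarrow> (real \<Rightarrow> real) \<Rightarrow> real \<Rightarrow> real" where
  "weak_deriv T q = (SOME r. r \<in> L2 T \<and> has_weak_derivative T q r)"

text \<open>The value \<open>q(T)\<close> is that of the representative of \<open>q\<close> which is continuous on \<open>[0,T]\<close>.\<close>

definition H10 :: "real \<Rightarrow> (real \<Rightarrow> real) set" where
  "H10 T = {q \<in> H1 T. \<exists>r. continuous_on {0..T} r \<and>
                (AE t in lebesgue_on {0<..<T}. q t = r t) \<and> r T = 0}"

definition H10S :: "real \<Rightarrow> bfun set" where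
  "H10S T = H10 T \<times> H10 T"

definition H10_normS :: "real \<Rightarrow> bfun \<Rightarrow> real" where
  "H10_normS T u = normS T (weak_deriv T (fst u), weak_deriv T (snd u))"

text \<open>
  The dual of \<open>H10S\<close>: bounded linear functionals, of which only the values on \<open>H10S T\<close> matter.
  Since \<open>H10_normS\<close> vanishes on functions that are zero almost everywhere, boundedness makes the
  functionals compatible with \<open>eqS\<close>.
\<close>

definition dualS :: "real \<Rightarrow> functional set" where
  "dualS T = {F. (\<forall>u\<in>H10S T. \<forall>v\<in>H10S T. F (u + v) = F u + F v) \<and>
                 (\<forall>c. \<forall>u\<in>H10S T. F (scaleS c u) = c * F u) \<and>
                 (\<exists>C. \<forall>u\<in>H10S T. \<bar>F u\<bar> \<le> C * H10_normS T u)}"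

definition dual_normS :: "real \<Rightarrow> functional \<Rightarrow> real" where
  "dual_normS T F = (SUP v \<in> {v \<in> H10S T. \<not> eqS T v 0}. F v / H10_normS T v)"

definition embS :: "real \<Rightarrow> bfun \<Rightarrow> functional" where
  "embS T u = (\<lambda>v. innerS T u v)"

definition single_layer :: "real \<Rightarrow> bfun \<Rightarrow> bfun" where
  "single_layer L w =
     (\<lambda>t. 1/2 * (LINT s:{0<..<t}|lebesgue. fst w s) + 1/2 * (LINT s:{0<..<t - L}|lebesgue. snd w s),
      \<lambda>t. 1/2 * (LINT s:{0<..<t - L}|lebesgue. fst w s) + 1/2 * (LINT s:{0<..<t}|lebesgue. snd w s))"

text \<open>
  \<open>V\<close> is the continuous (linear) extension of the single layer operator from \<open>L2S T\<close> to the dual.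
  As \<open>L2S T\<close> is dense in the dual, this determines \<open>V F\<close> up to \<open>eqS\<close> for every \<open>F \<in> dualS T\<close>.
\<close>

definition single_layer_extension :: "real \<Rightarrow> real \<Rightarrow> (functional \<Rightarrow> bfun) \<Rightarrow> bool" where
  "single_layer_extension L T V \<longleftrightarrow>
     (\<forall>F\<in>dualS T. V F \<in> L2S T) \<and>
     (\<forall>F\<in>dualS T. \<forall>G\<in>dualS T. eqS T (V (F + G)) (V F + V G)) \<and>
     (\<forall>c. \<forall>F\<in>dualS T. eqS T (V (\<lambda>v. c * F v)) (scaleS c (V F))) \<and>
     (\<exists>C. \<forall>F\<in>dualS T. normS T (V F) \<le> C * dual_normS T F) \<and>
     (\<forall>u\<in>L2S T. eqS T (V (embS T u)) (single_layer L u))"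

text \<open>
  A decomposition of \<open>(0,T)\<close> is given by its set of nodes, a mesh of \<open>\<Sigma>\<close> by the node sets of its two
  components; the elements are the open intervals between consecutive nodes.
\<close>

type_synonym mesh = "real set \<times> real set"

definition decomposition :: "real \<Rightarrow> real set \<Rightarrow> bool" where
  "decomposition T P \<longleftrightarrow> finite P \<and> 0 \<in> P \<and> T \<in> P \<and> P \<subseteq> {0..T}"

definition elements :: "real set \<Rightarrow> (real \<times> real) set" where
  "elements P = {(a, b). a \<in> P \<and> b \<in> P \<and> a < b \<and> P \<inter> {a<..<b} = {}}"

definition is_mesh :: "real \<Rightarrow> mesh \<Rightarrow> bool" where
  "is_mesh T M \<longleftrightarrow> decomposition T (fst M) \<and> decomposition T (snd M)"

definition mesh_size :: "mesh \<Rightarrow> real" where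
  "mesh_size M = Max ((\<lambda>(a, b). b - a) ` (elements (fst M) \<union> elements (snd M)))"

definition mesh_refines :: "mesh \<Rightarrow> mesh \<Rightarrow> bool" where
  "mesh_refines M' M \<longleftrightarrow> fst M \<subseteq> fst M' \<and> snd M \<subseteq> snd M'"

definition S0 :: "real \<Rightarrow> mesh \<Rightarrow> bfun set" where
  "S0 T M = {u \<in> L2S T.
     (\<forall>(a, b)\<in>elements (fst M). \<exists>c. AE t in lebesgue_on {a<..<b}. fst u t = c) \<and>
     (\<forall>(a, b)\<in>elements (snd M). \<exists>c. AE t in lebesgue_on {a<..<b}. snd u t = c)}"

end

theory Submission
  imports Defs
begin

text \<open>
  The lower bound follows by testing \<open>p\<^sub>h = \<Pi>\<^sub>h V (w - w\<^sub>H)\<close> with itself. For the upper bound, saturation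
  reduces the error to \<open>e = w\<^sub>H\<^sub>f - w\<^sub>H\<close>, with \<open>H\<^sub>f\<close> the finer mesh size. The Galerkin equations give
  \<open>\<langle>V e, q\<rangle> = \<langle>p - p', q\<rangle>\<close> for all \<open>q\<close> in the test space, where \<open>p = p\<^sub>h\<close> and \<open>p'\<close> is its analogue for
  the finer mesh, so the inf-sup condition bounds \<open>c\<^sub>S \<parallel>e\<parallel>\<close> by \<open>\<parallel>p - p'\<parallel>\<close>. As \<open>p'\<close> is orthogonal to
  \<open>V e\<close>, one has \<open>\<parallel>p - p'\<parallel>\<^sup>2 = \<langle>V e, p\<rangle> \<le> c\<^sub>2 \<parallel>e\<parallel> \<parallel>p\<parallel>\<close>, and a factor \<open>\<parallel>e\<parallel>\<close> cancels. A Poincare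
  inequality is what makes the functionals induced by \<open>L2S\<close> bounded.
\<close>

section \<open>The space \<open>L2\<close>\<close>

text \<open>Evaluating the form at \<open>s = c\<close>, \<open>t = - b\<close> leaves
  \<open>c * (a * c - b\<^sup>2)\<close>, and a positive \<open>c\<close> cancels. Only
  semidefiniteness is assumed, because inner products of representatives may vanish on nonzero
  functions; hence the separate case \<open>c = 0\<close>.\<close>

lemma Cauchy_Schwarz_quadratic_form:
  fixes a b c :: real
  assumes "\<And>s t. 0 \<le> s\<^sup>2 * a + 2 * s * t * b + t\<^sup>2 * c"
  shows "\<bar>b\<bar> \<le> sqrt a * sqrt c"
proof -
  have a: "0 \<le> a" using assms[of 1 0] by simp
  have c: "0 \<le> c" using assms[of 0 1] by simp
  have "b\<^sup>2 \<le> a * c"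
  proof (cases "c = 0")
    case True
    have "b = 0"
    proof (rule ccontr)
      assume "b \<noteq> 0"
      \<comment> \<open>With \<open>c = 0\<close> the form is affine in \<open>t\<close>, and this
        \<open>t\<close> gives it the value -1.\<close>
      then show False
        using assms[of 1 "- (a + 1) / (2 * b)"] True a by (simp add: field_simps)
    qed
    then show ?thesis using a c by simp
  next
    case False
    have "0 \<le> c\<^sup>2 * a + 2 * c * (- b) * b + (- b)\<^sup>2 * c" by (rule assms)
    also have "\<dots> = c * (a * c - b\<^sup>2)" by (simp add: power2_eq_square algebra_simps)
    finally show ?thesis using False c by (simp add: zero_le_mult_iff)
  qed
  then have "sqrt (b\<^sup>2) \<le> sqrt (a * c)" by (rule real_sqrt_le_mono)
  then show ?thesis by (simp add: real_sqrt_mult)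
qed

lemma finite_measure_interval: "finite_measure (lebesgue_on {a<..<b::real})"
  by (rule finite_measure_lebesgue_on) simp

lemma L2_measurable: "f \<in> L2 T \<Longrightarrow> f \<in> borel_measurable (lebesgue_on {0<..<T})"
  by (simp add: L2_def)

lemma L2_integrable_mult:
  assumes "f \<in> L2 T" "g \<in> L2 T"
  shows "integrable (lebesgue_on {0<..<T}) (\<lambda>t. f t * g t)"
proof (rule Bochner_Integration.integrable_bound)
  show "integrable (lebesgue_on {0<..<T}) (\<lambda>t. (f t)\<^sup>2 + (g t)\<^sup>2)"
    using assms by (simp add: L2_def)
  show "(\<lambda>t. f t * g t) \<in> borel_measurable (lebesgue_on {0<..<T})"
    using assms[THEN L2_measurable] by measurable
  have "\<bar>x * y\<bar> \<le> x\<^sup>2 + y\<^sup>2" for x y :: real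
  proof -
    have "2 * (\<bar>x\<bar> * \<bar>y\<bar>) \<le> x\<^sup>2 + y\<^sup>2"
      using sum_squares_bound[of "\<bar>x\<bar>" "\<bar>y\<bar>"] by (simp add: mult.assoc)
    moreover have "0 \<le> \<bar>x\<bar> * \<bar>y\<bar>" by simp
    ultimately show ?thesis unfolding abs_mult by linarith
  qed
  then show "AE t in lebesgue_on {0<..<T}. norm (f t * g t) \<le> norm ((f t)\<^sup>2 + (g t)\<^sup>2)"
    by simp
qed

lemma L2_const: "(\<lambda>_. c) \<in> L2 T"
  unfolding L2_def using finite_measure.integrable_const[OF finite_measure_interval] by simp

lemma L2_integrable: "f \<in> L2 T \<Longrightarrow> integrable (lebesgue_on {0<..<T}) f"
  using L2_integrable_mult[OF _ L2_const[of 1]] by simp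

lemma L2_linear:
  assumes "f \<in> L2 T" "g \<in> L2 T"
  shows "(\<lambda>t. a * f t + b * g t) \<in> L2 T"
proof -
  have "(\<lambda>t. a * f t + b * g t) \<in> borel_measurable (lebesgue_on {0<..<T})"
    using assms[THEN L2_measurable] by measurable
  moreover have "integrable (lebesgue_on {0<..<T})
      (\<lambda>t. a\<^sup>2 * (f t * f t) + 2 * a * b * (f t * g t) + b\<^sup>2 * (g t * g t))"
    using L2_integrable_mult assms by (intro Bochner_Integration.integrable_add integrable_mult_right) auto
  then have "integrable (lebesgue_on {0<..<T}) (\<lambda>t. (a * f t + b * g t)\<^sup>2)"
    by (simp add: power2_eq_square algebra_simps)
  ultimately show ?thesis by (simp add: L2_def)
qed

text \<open>Lebesgue measure is complete, so measurability passes to almost everywhere equal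
  functions; extension by zero transfers the question to the whole line.\<close>

lemma L2_cong_AE:
  assumes "f \<in> L2 T" and AE: "AE t in lebesgue_on {0<..<T}. f t = g t"
  shows "g \<in> L2 T"
proof -
  let ?S = "{0<..<T}"
  have "(\<lambda>t. if t \<in> ?S then f t else 0) \<in> borel_measurable lebesgue"
    using L2_measurable[OF assms(1)] by (subst borel_measurable_if) auto
  moreover have "AE t in lebesgue. (if t \<in> ?S then f t else 0) = (if t \<in> ?S then g t else 0)"
    using AE by (subst (asm) AE_restrict_space_iff) auto
  ultimately have "(\<lambda>t. if t \<in> ?S then g t else 0) \<in> borel_measurable lebesgue"
    by (rule borel_measurable_AE)
  then have g: "g \<in> borel_measurable (lebesgue_on ?S)"
    by (subst (asm) borel_measurable_if) auto
  have "integrable (lebesgue_on ?S) (\<lambda>t. (f t)\<^sup>2) = integrable (lebesgue_on ?S) (\<lambda>t. (g t)\<^sup>2)"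
    using L2_measurable[OF assms(1)] g AE by (intro integrable_cong_AE) auto
  then show ?thesis using assms(1) g by (simp add: L2_def)
qed

lemma L2_inner_cong_AE:
  assumes "f \<in> L2 T" "g \<in> L2 T"
    and "AE t in lebesgue_on {0<..<T}. f t = f' t" "AE t in lebesgue_on {0<..<T}. g t = g' t"
  shows "L2_inner T f g = L2_inner T f' g'"
  unfolding L2_inner_def
proof (rule integral_cong_AE)
  have "f' \<in> L2 T" "g' \<in> L2 T" using assms L2_cong_AE by blast+
  then show "(\<lambda>t. f' t * g' t) \<in> borel_measurable (lebesgue_on {0<..<T})"
    using L2_measurable by (intro borel_measurable_times) auto
  show "(\<lambda>t. f t * g t) \<in> borel_measurable (lebesgue_on {0<..<T})"
    using L2_measurable assms by (intro borel_measurable_times) auto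
qed (use assms(3,4) in eventually_elim, simp)

lemma L2_inner_commute: "L2_inner T f g = L2_inner T g f"
  by (simp add: L2_inner_def mult.commute)

lemma L2_inner_linear:
  assumes "f \<in> L2 T" "g \<in> L2 T" "k \<in> L2 T"
  shows "L2_inner T (\<lambda>t. a * f t + b * g t) k = a * L2_inner T f k + b * L2_inner T g k"
proof -
  have "L2_inner T (\<lambda>t. a * f t + b * g t) k
      = (LINT t|lebesgue_on {0<..<T}. a * (f t * k t) + b * (g t * k t))"
    by (simp add: L2_inner_def algebra_simps)
  also have "\<dots> = a * L2_inner T f k + b * L2_inner T g k"
    unfolding L2_inner_def using assms L2_integrable_mult
    by (subst Bochner_Integration.integral_add) auto
  finally show ?thesis .
qed

lemma L2_inner_nonneg: "0 \<le> L2_inner T f f"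
  by (simp add: L2_inner_def)

lemma L2_inner_quadratic:
  assumes "f \<in> L2 T" "g \<in> L2 T"
  shows "0 \<le> s\<^sup>2 * L2_inner T f f + 2 * s * t * L2_inner T f g + t\<^sup>2 * L2_inner T g g"
proof -
  let ?h = "\<lambda>x. s * f x + t * g x"
  have "L2_inner T ?h ?h = s * L2_inner T ?h f + t * L2_inner T ?h g"
    using assms L2_linear[OF assms] by (subst L2_inner_linear) (auto simp: L2_inner_commute)
  also have "\<dots> = s\<^sup>2 * L2_inner T f f + 2 * s * t * L2_inner T f g + t\<^sup>2 * L2_inner T g g"
    using assms by (simp add: L2_inner_linear L2_inner_commute[of T g f] power2_eq_square algebra_simps)
  finally show ?thesis using L2_inner_nonneg[of T ?h] by simp
qed

lemma L2_Cauchy_Schwarz: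
  assumes "f \<in> L2 T" "g \<in> L2 T"
  shows "\<bar>L2_inner T f g\<bar> \<le> sqrt (L2_inner T f f) * sqrt (L2_inner T g g)"
  by (rule Cauchy_Schwarz_quadratic_form) (rule L2_inner_quadratic[OF assms])

section \<open>The space \<open>L2S\<close>\<close>

lemma L2S_diff: "u \<in> L2S T \<Longrightarrow> v \<in> L2S T \<Longrightarrow> u - v \<in> L2S T"
  using L2_linear[of "fst u" T "fst v" 1 "-1"] L2_linear[of "snd u" T "snd v" 1 "-1"]
  by (cases u; cases v) (simp add: L2S_def fun_diff_def)

lemma innerS_commute: "innerS T u v = innerS T v u"
  by (simp add: innerS_def L2_inner_commute)

lemma innerS_add_left:
  "u \<in> L2S T \<Longrightarrow> v \<in> L2S T \<Longrightarrow> z \<in> L2S T \<Longrightarrow> innerS T (u + v) z = innerS T u z + innerS T v z"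
  using L2_inner_linear[of "fst u" T "fst v" "fst z" 1 1]
    L2_inner_linear[of "snd u" T "snd v" "snd z" 1 1]
  by (cases u; cases v; cases z) (simp add: L2S_def innerS_def plus_fun_def)

lemma innerS_diff_left:
  "u \<in> L2S T \<Longrightarrow> v \<in> L2S T \<Longrightarrow> z \<in> L2S T \<Longrightarrow> innerS T (u - v) z = innerS T u z - innerS T v z"
  using L2_inner_linear[of "fst u" T "fst v" "fst z" 1 "-1"]
    L2_inner_linear[of "snd u" T "snd v" "snd z" 1 "-1"]
  by (cases u; cases v; cases z) (simp add: L2S_def innerS_def fun_diff_def)

lemma innerS_add_right:
  "u \<in> L2S T \<Longrightarrow> v \<in> L2S T \<Longrightarrow> z \<in> L2S T \<Longrightarrow> innerS T z (u + v) = innerS T z u + innerS T z v"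
  using innerS_add_left by (simp add: innerS_commute[of T z])

lemma innerS_diff_right:
  "u \<in> L2S T \<Longrightarrow> v \<in> L2S T \<Longrightarrow> z \<in> L2S T \<Longrightarrow> innerS T z (u - v) = innerS T z u - innerS T z v"
  using innerS_diff_left by (simp add: innerS_commute[of T z])

lemma innerS_scale_right: "innerS T z (scaleS c u) = c * innerS T z u"
  by (simp add: innerS_def L2_inner_def scaleS_def algebra_simps flip: integral_mult_right_zero)

lemma normS_nonneg: "0 \<le> normS T u"
  by (simp add: normS_def L2_inner_nonneg)

lemma normS_power2: "(normS T u)\<^sup>2 = innerS T u u"
  by (simp add: normS_def innerS_def L2_inner_nonneg)

lemma innerS_Cauchy_Schwarz:
  assumes "u \<in> L2S T" "v \<in> L2S T"
  shows "\<bar>innerS T u v\<bar> \<le> normS T u * normS T v"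
  unfolding normS_def
proof (rule Cauchy_Schwarz_quadratic_form)
  fix s t :: real
  have "fst u \<in> L2 T" "fst v \<in> L2 T" "snd u \<in> L2 T" "snd v \<in> L2 T"
    using assms by (auto simp: L2S_def)
  then show "0 \<le> s\<^sup>2 * (L2_inner T (fst u) (fst u) + L2_inner T (snd u) (snd u)) +
      2 * s * t * innerS T u v + t\<^sup>2 * (L2_inner T (fst v) (fst v) + L2_inner T (snd v) (snd v))"
    using L2_inner_quadratic[of "fst u" T "fst v" s t] L2_inner_quadratic[of "snd u" T "snd v" s t]
    by (simp add: innerS_def algebra_simps)
qed

lemma L2S_cong: "u \<in> L2S T \<Longrightarrow> eqS T u v \<Longrightarrow> v \<in> L2S T"
  using L2_cong_AE by (auto simp: L2S_def eqS_def mem_Times_iff)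

lemma innerS_cong:
  "u \<in> L2S T \<Longrightarrow> v \<in> L2S T \<Longrightarrow> eqS T u u' \<Longrightarrow> innerS T u v = innerS T u' v"
  unfolding innerS_def eqS_def L2S_def by (intro arg_cong2[where f = "(+)"] L2_inner_cong_AE) auto

text \<open>Glues additivity, homogeneity with factor -1 and the identification of two values into
  one statement about a difference, all up to null sets.\<close>

lemma eqS_diff_add_scale:
  assumes "eqS T x (a + b)" "eqS T a a'" "eqS T b (scaleS (-1) b')" "eqS T b' b''"
  shows "eqS T x (a' - b'')"
proof -
  have 1: "AE t in lebesgue_on {0<..<T}. fst x t = fst (a' - b'') t"
  proof -
    have "AE t in lebesgue_on {0<..<T}. fst x t = fst (a + b) t"
      "AE t in lebesgue_on {0<..<T}. fst a t = fst a' t"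
      "AE t in lebesgue_on {0<..<T}. fst b t = fst (scaleS (-1) b') t"
      "AE t in lebesgue_on {0<..<T}. fst b' t = fst b'' t"
      using assms by (auto simp: eqS_def)
    then show ?thesis by eventually_elim (simp add: scaleS_def)
  qed
  have 2: "AE t in lebesgue_on {0<..<T}. snd x t = snd (a' - b'') t"
  proof -
    have "AE t in lebesgue_on {0<..<T}. snd x t = snd (a + b) t"
      "AE t in lebesgue_on {0<..<T}. snd a t = snd a' t"
      "AE t in lebesgue_on {0<..<T}. snd b t = snd (scaleS (-1) b') t"
      "AE t in lebesgue_on {0<..<T}. snd b' t = snd b'' t"
      using assms by (auto simp: eqS_def)
    then show ?thesis by eventually_elim (simp add: scaleS_def)
  qed
  show ?thesis using 1 2 by (simp add: eqS_def)
qed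

text \<open>Provides elements for the index sets of the suprema; it holds since (0,T) has positive
  measure.\<close>

lemma not_eqS_0I:
  assumes "0 < T" and "\<And>t. t \<in> {0<..<T} \<Longrightarrow> fst u t \<noteq> 0"
  shows "\<not> eqS T u 0"
proof
  assume "eqS T u 0"
  then have "AE t in lebesgue_on {0<..<T}. fst u t = 0" by (simp add: eqS_def)
  moreover have "AE t in lebesgue_on {0<..<T}. fst u t \<noteq> 0"
    by (rule AE_I2) (simp add: assms(2))
  ultimately have "AE t in lebesgue_on {0<..<T}. False" by eventually_elim simp
  then have "emeasure (lebesgue_on {0<..<T}) {0<..<T} = 0"
    using AE_iff_null_sets[of "{0<..<T}" "lebesgue_on {0<..<T}"]
    by (auto simp: null_sets_def elim: eventually_mono)
  then show False using assms(1) by (simp add: emeasure_restrict_space)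
qed

section \<open>A Poincare inequality for \<open>H10\<close>\<close>

text \<open>A bridge to the gauge integral, for which the fundamental theorem of calculus is
  available; the endpoints form a null set.\<close>

lemma continuous_lebesgue_on_open_interval:
  fixes f :: "real \<Rightarrow> real"
  assumes "continuous_on {a..b} f"
  shows "integrable (lebesgue_on {a<..<b}) f"
    and "(LINT t|lebesgue_on {a<..<b}. f t) = integral {a..b} f"
proof -
  have "set_integrable lebesgue {a..b} f"
    using continuous_imp_integrable_real[OF assms]
    by (simp add: set_integrable_def integrable_restrict_space)
  then have "set_integrable lebesgue {a<..<b} f"
    by (rule set_integrable_subset) auto
  then show i: "integrable (lebesgue_on {a<..<b}) f"
    by (simp add: set_integrable_def integrable_restrict_space)
  show "(LINT t|lebesgue_on {a<..<b}. f t) = integral {a..b} f"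
    using lebesgue_integral_eq_integral[OF i] by (simp add: integral_open_interval_real)
qed

lemma continuous_in_L2: "continuous_on {0..T} f \<Longrightarrow> f \<in> L2 T"
  unfolding L2_def
  using continuous_lebesgue_on_open_interval(1)[of 0 T f]
    continuous_lebesgue_on_open_interval(1)[of 0 T "\<lambda>t. (f t)\<^sup>2"]
  by (auto intro: continuous_on_power)

text \<open>For \<open>e > 0\<close>, the hat function of height \<open>e\<close> and slopes 1 and
  -1 supported on \<open>[a - e, a + e]\<close>, written as a second difference of the positive
  part.\<close>

definition tent :: "real \<Rightarrow> real \<Rightarrow> real \<Rightarrow> real" where
  "tent e a x = max 0 (x - a + e) - 2 * max 0 (x - a) + max 0 (x - a - e)"

text \<open>The primitive of \<open>tent\<close>: a continuously differentiable step from 0 up to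
  \<open>e\<^sup>2\<close>. Without normalisation no division by \<open>e\<close> occurs.\<close>

definition ramp :: "real \<Rightarrow> real \<Rightarrow> real \<Rightarrow> real" where
  "ramp e a x = ((max 0 (x - a + e))\<^sup>2 - 2 * (max 0 (x - a))\<^sup>2 + (max 0 (x - a - e))\<^sup>2) / 2"

text \<open>Away from the kink the function is locally a square or locally zero; at the kink the
  difference quotient is at most \<open>\<bar>h\<bar>\<close>. This is why \<open>ramp\<close> is
  smooth enough for a test function.\<close>

lemma has_derivative_max_power2:
  "((\<lambda>x::real. (max 0 (x + c))\<^sup>2) has_real_derivative 2 * max 0 (x + c)) (at x)"
proof -
  consider "x + c > 0" | "x + c < 0" | "x = - c" by linarith
  then show ?thesis
  proof cases
    case 1
    have "((\<lambda>x. (x + c)\<^sup>2) has_real_derivative 2 * max 0 (x + c)) (at x)"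
      using 1 by (auto intro!: derivative_eq_intros)
    moreover have "\<forall>\<^sub>F y in nhds x. (y + c)\<^sup>2 = (max 0 (y + c))\<^sup>2"
      using eventually_nhds_in_open[of "{-c<..}" x] 1 by (auto elim!: eventually_mono)
    ultimately show ?thesis using DERIV_cong_ev[OF refl _ refl] by fast
  next
    case 2
    have "((\<lambda>x. 0) has_real_derivative 2 * max 0 (x + c)) (at x)"
      using 2 by (auto intro!: derivative_eq_intros)
    moreover have "\<forall>\<^sub>F y in nhds x. 0 = (max 0 (y + c))\<^sup>2"
      using eventually_nhds_in_open[of "{..<-c}" x] 2 by (auto elim!: eventually_mono)
    ultimately show ?thesis using DERIV_cong_ev[OF refl _ refl] by fast
  next
    case 3
    have "((\<lambda>h. ((max 0 (h::real))\<^sup>2) / h) \<longlongrightarrow> 0) (at 0)"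
    proof (rule Lim_null_comparison)
      show "\<forall>\<^sub>F h::real in at 0. norm (((max 0 h)\<^sup>2) / h) \<le> \<bar>h\<bar>"
        by (rule always_eventually) (auto simp: max_def power2_eq_square)
      show "((\<lambda>h. \<bar>h\<bar>) \<longlongrightarrow> 0) (at (0::real))"
        by (auto intro!: tendsto_eq_intros)
    qed
    then show ?thesis using 3 by (simp add: DERIV_def)
  qed
qed

lemma ramp_has_derivative: "(ramp e a has_real_derivative tent e a x) (at x)"
proof -
  have "((\<lambda>x. ((max 0 (x + (e - a)))\<^sup>2 - 2 * (max 0 (x + - a))\<^sup>2 + (max 0 (x + (- a - e)))\<^sup>2) / 2)
      has_real_derivative
      (2 * max 0 (x + (e - a)) - 2 * (2 * max 0 (x + - a)) + 2 * max 0 (x + (- a - e))) / 2) (at x)"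
    by (intro DERIV_cdivide DERIV_add DERIV_diff DERIV_cmult has_derivative_max_power2)
  moreover have "(2 * max 0 (x + (e - a)) - 2 * (2 * max 0 (x + - a)) + 2 * max 0 (x + (- a - e))) / 2
      = tent e a x"
    by (simp add: tent_def add.commute add_diff_eq diff_add_eq)
  ultimately show ?thesis by (simp add: ramp_def[abs_def] algebra_simps)
qed

section \<open>Support, bounds and mass of tents and ramps\<close>

lemma continuous_on_tent: "continuous_on S (tent e a)"
  unfolding tent_def[abs_def] by (intro continuous_intros)

lemma tent_nonneg: "0 \<le> tent e a x"
  by (auto simp: tent_def max_def)

lemma tent_eq_0: "e \<le> \<bar>x - a\<bar> \<Longrightarrow> 0 \<le> e \<Longrightarrow> tent e a x = 0"
  by (auto simp: tent_def max_def)

lemma ramp_left: "x \<le> a - e \<Longrightarrow> 0 \<le> e \<Longrightarrow> ramp e a x = 0"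
  by (simp add: ramp_def max_absorb1)

lemma ramp_right: "a + e \<le> x \<Longrightarrow> 0 \<le> e \<Longrightarrow> ramp e a x = e\<^sup>2"
  by (simp add: ramp_def max_absorb2) (simp add: power2_eq_square algebra_simps)

lemma ramp_mono: "x \<le> y \<Longrightarrow> ramp e a x \<le> ramp e a y"
  using DERIV_nonneg_imp_nondecreasing[of x y "ramp e a"] ramp_has_derivative tent_nonneg by blast

text \<open>By monotonicity, comparison with points to the left and to the right of the transition
  zone suffices; \<open>min\<close> and \<open>max\<close> produce such points.\<close>

lemma ramp_bounds:
  assumes "0 \<le> e" shows "0 \<le> ramp e a x" "ramp e a x \<le> e\<^sup>2"
  using ramp_mono[of "min x (a - e)" x e a] ramp_left[of "min x (a - e)" a e]
    ramp_mono[of x "max x (a + e)" e a] ramp_right[of a e "max x (a + e)"] assms by auto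

lemma integral_tent:
  assumes "0 \<le> e" "0 \<le> a - e" "a + e \<le> T"
  shows "(LINT t|lebesgue_on {0<..<T}. tent e a t) = e\<^sup>2"
proof -
  have "(tent e a has_integral (ramp e a T - ramp e a 0)) {0..T}"
    using assms ramp_has_derivative
    by (intro fundamental_theorem_of_calculus)
      (auto simp: has_real_derivative_iff_has_vector_derivative[symmetric] intro: has_field_derivative_at_within)
  then show ?thesis
    using assms continuous_lebesgue_on_open_interval(2)[OF continuous_on_tent, of 0 T e a]
    by (simp add: integral_unique ramp_left ramp_right)
qed

text \<open>The tent is an unnormalised mollifier: it is nonnegative, has mass
  \<open>e\<^sup>2\<close> and vanishes where \<open>q\<close> is not controlled.\<close>

lemma tent_average:
  assumes q: "continuous_on {0..T} q" and "0 < e" "0 \<le> a - e" "a + e \<le> T"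
    and close: "\<And>t. \<bar>t - a\<bar> < e \<Longrightarrow> \<bar>q t - q a\<bar> \<le> \<eta>"
  shows "\<bar>(LINT t|lebesgue_on {0<..<T}. q t * tent e a t) - q a * e\<^sup>2\<bar> \<le> \<eta> * e\<^sup>2"
proof -
  let ?M = "lebesgue_on {0<..<T}"
  have int: "integrable ?M (\<lambda>t. q t * tent e a t)" "integrable ?M (tent e a)"
    using q continuous_on_tent
    by (auto intro!: continuous_lebesgue_on_open_interval(1) continuous_on_mult)
  have "(LINT t|?M. q t * tent e a t) - q a * e\<^sup>2 = (LINT t|?M. q t * tent e a t - q a * tent e a t)"
    using int integral_tent[of e a T] assms by (subst Bochner_Integration.integral_diff) auto
  also have "\<bar>\<dots>\<bar> \<le> (LINT t|?M. \<eta> * tent e a t)"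
  proof (rule integral_abs_bound_integral)
    fix t
    show "\<bar>q t * tent e a t - q a * tent e a t\<bar> \<le> \<eta> * tent e a t"
    proof (cases "\<bar>t - a\<bar> < e")
      case True
      have "\<bar>q t * tent e a t - q a * tent e a t\<bar> = \<bar>q t - q a\<bar> * tent e a t"
        using tent_nonneg[of e a t] by (simp add: abs_mult flip: left_diff_distrib)
      then show ?thesis using close[OF True] tent_nonneg by (simp add: mult_right_mono)
    next
      case False
      then show ?thesis using tent_eq_0[of e t a] assms(2) by simp
    qed
  qed (use int in auto)
  also have "\<dots> = \<eta> * e\<^sup>2" using integral_tent[of e a T] assms by simp
  finally show ?thesis .
qed

text \<open>Left of both transitions the two ramps vanish, right of both they equal
  \<open>e\<^sup>2\<close> and cancel, so the support is compact. The order of \<open>a\<close> and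
  \<open>b\<close> is left open.\<close>

lemma test_function_ramp_diff:
  assumes "0 < e" "e < a" "a + e < T" "e < b" "b + e < T"
  shows "(\<lambda>t. ramp e a t - ramp e b t) \<in> test_functions T"
    and "deriv (\<lambda>t. ramp e a t - ramp e b t) = (\<lambda>t. tent e a t - tent e b t)"
proof -
  let ?\<phi> = "\<lambda>t. ramp e a t - ramp e b t"
  have d: "(?\<phi> has_real_derivative tent e a x - tent e b x) (at x)" for x
    by (intro DERIV_diff ramp_has_derivative)
  then show "deriv ?\<phi> = (\<lambda>t. tent e a t - tent e b t)"
    by (intro ext DERIV_imp_deriv)
  have "?\<phi> C1_differentiable_on UNIV"
    unfolding C1_differentiable_on_def
    using d continuous_on_tent
    by (intro exI[of _ "\<lambda>t. tent e a t - tent e b t"])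
      (auto simp: has_real_derivative_iff_has_vector_derivative intro: continuous_on_diff)
  moreover have "?\<phi> t = 0" if "t \<notin> {min a b - e..max a b + e}" for t
    using that assms ramp_left[of t a e] ramp_left[of t b e] ramp_right[of a e t] ramp_right[of b e t]
    by (cases "t < min a b - e") (auto simp: min_def max_def split: if_splits)
  moreover have "{min a b - e..max a b + e} \<subseteq> {0<..<T}" using assms by auto
  ultimately show "?\<phi> \<in> test_functions T"
    unfolding test_functions_def by (blast intro: compact_Icc)
qed

text \<open>Testing with a narrow ramp up at \<open>a\<close> and down at \<open>b\<close> recovers \<open>q a - q b\<close>; this avoids
  the representation of \<open>q\<close> as the integral of its weak derivative.\<close>

lemma weak_derivative_increment:
  assumes q: "continuous_on {0..T} q" and r: "r \<in> L2 T" and wd: "has_weak_derivative T q r"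
    and a: "0 < a" "a < T" and b: "0 < b" "b < T"
  shows "\<bar>q a - q b\<bar> \<le> sqrt T * sqrt (L2_inner T r r)"
proof (rule field_le_epsilon)
  fix \<eta> :: real assume "0 < \<eta>"
  let ?M = "lebesgue_on {0<..<T}"
  have near: "\<exists>d>0. \<forall>t. \<bar>t - c\<bar> < d \<longrightarrow> \<bar>q t - q c\<bar> \<le> \<eta> / 2" if "0 < c" "c < T" for c
  proof -
    have "isCont q c" using q that by (intro continuous_on_interior) auto
    then obtain d where "0 < d" "\<And>t. \<bar>t - c\<bar> < d \<Longrightarrow> \<bar>q t - q c\<bar> < \<eta> / 2"
      using \<open>0 < \<eta>\<close> unfolding continuous_at_eps_delta by (metis dist_real_def half_gt_zero)
    then show ?thesis using less_imp_le by blast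
  qed
  obtain da where da: "0 < da" "\<And>t. \<bar>t - a\<bar> < da \<Longrightarrow> \<bar>q t - q a\<bar> \<le> \<eta> / 2" using near[OF a] by blast
  obtain db where db: "0 < db" "\<And>t. \<bar>t - b\<bar> < db \<Longrightarrow> \<bar>q t - q b\<bar> \<le> \<eta> / 2" using near[OF b] by blast
  \<comment> \<open>A strictly smaller \<open>e\<close> keeps both tents inside the neighbourhoods
    where \<open>q\<close> is nearly constant, and their supports inside the open interval.\<close>
  have "0 < min da (min db (min (min a b) (min (T - a) (T - b))))" using da(1) db(1) a b by simp
  then obtain e where "0 < e" and e_less: "e < min da (min db (min (min a b) (min (T - a) (T - b))))"
    using dense by blast
  then have e: "0 < e" "e < a" "a + e < T" "e < b" "b + e < T" and e_le: "e \<le> da" "e \<le> db" by auto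
  let ?\<phi> = "\<lambda>t. ramp e a t - ramp e b t"
  have avg_a: "\<bar>(LINT t|?M. q t * tent e a t) - q a * e\<^sup>2\<bar> \<le> \<eta> / 2 * e\<^sup>2"
    using e e_le da by (intro tent_average q) auto
  have avg_b: "\<bar>(LINT t|?M. q t * tent e b t) - q b * e\<^sup>2\<bar> \<le> \<eta> / 2 * e\<^sup>2"
    using e e_le db by (intro tent_average q) auto
  have "continuous_on {0..T} ?\<phi>"
    by (intro continuous_on_diff DERIV_continuous_on) (auto intro: has_field_derivative_at_within ramp_has_derivative)
  then have \<phi>: "?\<phi> \<in> L2 T" by (rule continuous_in_L2)
  \<comment> \<open>Both ramps take values between 0 and \<open>e\<^sup>2\<close>, so their
    difference is at most \<open>e\<^sup>2\<close> in modulus.\<close>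
  have \<phi>_le: "(?\<phi> t)\<^sup>2 \<le> (e\<^sup>2)\<^sup>2" for t
    using ramp_bounds[of e a t] ramp_bounds[of e b t] e by (intro abs_le_square_iff[THEN iffD1]) auto
  have "L2_inner T ?\<phi> ?\<phi> \<le> (LINT t|?M. (e\<^sup>2)\<^sup>2)"
    unfolding L2_inner_def
  proof (rule integral_mono)
    show "integrable ?M (\<lambda>t. ?\<phi> t * ?\<phi> t)" by (rule L2_integrable_mult[OF \<phi> \<phi>])
    show "integrable ?M (\<lambda>t. (e\<^sup>2)\<^sup>2)" by (rule L2_integrable[OF L2_const])
    show "?\<phi> t * ?\<phi> t \<le> (e\<^sup>2)\<^sup>2" for t using \<phi>_le[of t] by (simp add: power2_eq_square[of "?\<phi> t"])
  qed
  also have "\<dots> = T * (e\<^sup>2)\<^sup>2" using a by (simp add: measure_restrict_space)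
  finally have "sqrt (L2_inner T ?\<phi> ?\<phi>) \<le> sqrt (T * (e\<^sup>2)\<^sup>2)" by (rule real_sqrt_le_mono)
  then have norm_\<phi>: "sqrt (L2_inner T ?\<phi> ?\<phi>) \<le> sqrt T * e\<^sup>2"
    unfolding real_sqrt_mult real_sqrt_abs by simp
  have "L2_inner T q (deriv ?\<phi>) = - L2_inner T r ?\<phi>"
    using wd test_function_ramp_diff(1)[OF e] by (simp add: has_weak_derivative_def)
  moreover have "L2_inner T q (deriv ?\<phi>)
      = (LINT t|?M. q t * tent e a t) - (LINT t|?M. q t * tent e b t)"
    unfolding L2_inner_def test_function_ramp_diff(2)[OF e] right_diff_distrib
    using q continuous_on_tent
    by (intro Bochner_Integration.integral_diff continuous_lebesgue_on_open_interval(1) continuous_on_mult)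
  moreover have "\<bar>L2_inner T r ?\<phi>\<bar> \<le> sqrt (L2_inner T r r) * (sqrt T * e\<^sup>2)"
    using L2_Cauchy_Schwarz[OF r \<phi>] mult_left_mono[OF norm_\<phi>, of "sqrt (L2_inner T r r)"] L2_inner_nonneg[of T r]
    by simp
  \<comment> \<open>Every term carries \<open>e\<^sup>2\<close>, from the mass of the tents or from
    the bound on the ramps, so this factor cancels.\<close>
  ultimately have "\<bar>q a * e\<^sup>2 - q b * e\<^sup>2\<bar> \<le> sqrt (L2_inner T r r) * (sqrt T * e\<^sup>2) + \<eta> * e\<^sup>2"
    using avg_a avg_b by linarith
  then have "\<bar>q a - q b\<bar> * e\<^sup>2 \<le> (sqrt T * sqrt (L2_inner T r r) + \<eta>) * e\<^sup>2"
    unfolding left_diff_distrib[symmetric] abs_mult by (simp add: algebra_simps)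
  then show "\<bar>q a - q b\<bar> \<le> sqrt T * sqrt (L2_inner T r r) + \<eta>"
    using e by (simp add: mult_le_cancel_right)
qed

section \<open>From increments to the Poincare inequality\<close>

lemma H10_in_L2: "q \<in> H10 T \<Longrightarrow> q \<in> L2 T"
  by (simp add: H10_def H1_def)

lemma weak_deriv:
  assumes "q \<in> H1 T"
  shows "weak_deriv T q \<in> L2 T" "has_weak_derivative T q (weak_deriv T q)"
  using someI_ex[of "\<lambda>r. r \<in> L2 T \<and> has_weak_derivative T q r"] assms
  by (auto simp: H1_def weak_deriv_def)

lemma test_function_in_L2:
  assumes "\<phi> \<in> test_functions T" shows "\<phi> \<in> L2 T" "deriv \<phi> \<in> L2 T"
proof -
  obtain D where D: "\<And>t. (\<phi> has_real_derivative D t) (at t)" "continuous_on UNIV D"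
    using assms by (auto simp: test_functions_def C1_differentiable_on_def has_real_derivative_iff_has_vector_derivative)
  have "deriv \<phi> = D" using D(1) by (intro ext DERIV_imp_deriv)
  then show "deriv \<phi> \<in> L2 T" using D(2) by (auto intro: continuous_in_L2 continuous_on_subset)
  show "\<phi> \<in> L2 T"
    using D(1) by (intro continuous_in_L2 DERIV_continuous_on) (auto intro: has_field_derivative_at_within)
qed

text \<open>The continuous representative vanishes at \<open>T\<close>, so its increments up to
  \<open>T\<close> bound it pointwise by \<open>sqrt T\<close> times the norm of the derivative.
  Squaring and integrating over (0,T) gives the factor \<open>T\<^sup>2\<close>.\<close>

lemma Poincare_H10:
  assumes "0 < T" and "q \<in> H10 T"
  shows "L2_inner T q q \<le> T\<^sup>2 * L2_inner T (weak_deriv T q) (weak_deriv T q)"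
proof -
  let ?M = "lebesgue_on {0<..<T}" and ?r = "weak_deriv T q"
  obtain p where p: "continuous_on {0..T} p" "AE t in ?M. q t = p t" "p T = 0"
    using assms by (auto simp: H10_def)
  have r: "?r \<in> L2 T" "has_weak_derivative T q ?r"
    using assms weak_deriv by (auto simp: H10_def)
  \<comment> \<open>Weak derivatives see only inner products, so they carry over from
    \<open>q\<close> to its continuous representative.\<close>
  have qp: "L2_inner T q f = L2_inner T p f" if "f \<in> L2 T" for f
    using that p(2) H10_in_L2[OF assms(2)] by (intro L2_inner_cong_AE) auto
  have wd: "has_weak_derivative T p ?r"
    using r(2) test_function_in_L2 by (simp add: has_weak_derivative_def qp[symmetric])
  define K where "K = sqrt T * sqrt (L2_inner T ?r ?r)"
  \<comment> \<open>The increment bound concerns interior points only; the value at \<open>T\<close>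
    enters as a limit from the left.\<close>
  have p_le: "\<bar>p a\<bar> \<le> K" if a: "0 < a" "a < T" for a
  proof (rule tendsto_upperbound)
    have "(p \<longlongrightarrow> p T) (at T within {0..T})"
      using p(1) assms(1) by (simp add: continuous_on)
    then have "(p \<longlongrightarrow> 0) (at_left T)"
      using assms(1) p(3) by (simp add: at_within_Icc_at_left)
    then have "((\<lambda>b. \<bar>p a - p b\<bar>) \<longlongrightarrow> \<bar>p a - 0\<bar>) (at_left T)" by (intro tendsto_intros)
    then show "((\<lambda>b. \<bar>p a - p b\<bar>) \<longlongrightarrow> \<bar>p a\<bar>) (at_left T)" by simp
    show "\<forall>\<^sub>F b in at_left T. \<bar>p a - p b\<bar> \<le> K"
      using eventually_at_left_real[OF assms(1)]
      by eventually_elim (use weak_derivative_increment[OF p(1) r(1) wd a] in \<open>simp add: K_def\<close>)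
  qed simp
  have "L2_inner T q q = L2_inner T p p"
    using p(2) H10_in_L2[OF assms(2)] by (intro L2_inner_cong_AE) auto
  also have "\<dots> \<le> (LINT t|?M. K\<^sup>2)"
    unfolding L2_inner_def
  proof (rule integral_mono)
    show "integrable ?M (\<lambda>t. p t * p t)" using continuous_in_L2[OF p(1)] L2_integrable_mult by blast
    show "integrable ?M (\<lambda>t. K\<^sup>2)" by (rule L2_integrable[OF L2_const])
    show "p t * p t \<le> K\<^sup>2" if "t \<in> space ?M" for t
      using power_mono[OF p_le[of t], of 2] that by (simp add: power2_eq_square)
  qed
  also have "\<dots> = T * K\<^sup>2" using assms by (simp add: measure_restrict_space)
  also have "\<dots> = T\<^sup>2 * L2_inner T ?r ?r"
    using assms L2_inner_nonneg[of T ?r] by (simp add: K_def power_mult_distrib power2_eq_square[of T])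
  finally show ?thesis .
qed

lemma normS_le_H10_normS:
  assumes "0 < T" and "v \<in> H10S T"
  shows "normS T v \<le> T * H10_normS T v"
proof -
  have "normS T v \<le> sqrt (T\<^sup>2 * (L2_inner T (weak_deriv T (fst v)) (weak_deriv T (fst v)) +
      L2_inner T (weak_deriv T (snd v)) (weak_deriv T (snd v))))"
    using assms Poincare_H10[of T "fst v"] Poincare_H10[of T "snd v"]
    by (auto simp: normS_def H10S_def algebra_simps)
  also have "\<dots> = T * H10_normS T v"
    using assms by (simp add: H10_normS_def normS_def real_sqrt_mult)
  finally show ?thesis .
qed

text \<open>Supplies a nonzero element of the space, so that the supremum in
  \<open>dual_normS\<close> runs over a nonempty set. The weak derivative -1 comes from integration
  by parts.\<close>

lemma linear_in_H10:
  assumes "0 < T" shows "(\<lambda>t. T - t) \<in> H10 T"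
proof -
  have c: "continuous_on {0..T} (\<lambda>t. T - t)" by (intro continuous_intros)
  have "L2_inner T (\<lambda>t. T - t) (deriv \<phi>) = - L2_inner T (\<lambda>_. - 1) \<phi>"
    if \<phi>: "\<phi> \<in> test_functions T" for \<phi>
  proof -
    let ?M = "lebesgue_on {0<..<T}"
    obtain D where D: "\<And>t. (\<phi> has_real_derivative D t) (at t)" "continuous_on UNIV D"
      using \<phi> by (auto simp: test_functions_def C1_differentiable_on_def has_real_derivative_iff_has_vector_derivative)
    have eq: "deriv \<phi> = D" using D(1) by (intro ext DERIV_imp_deriv)
    have zero: "\<phi> 0 = 0" using \<phi> by (force simp: test_functions_def)
    have cD: "continuous_on {0..T} D" using D(2) continuous_on_subset by blast
    have c\<phi>: "continuous_on {0..T} \<phi>"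
      using D(1) by (intro DERIV_continuous_on) (auto intro: has_field_derivative_at_within)
    \<comment> \<open>Both boundary terms vanish: \<open>T - t\<close> at the right end and
      \<open>\<phi>\<close> at the left end.\<close>
    have "((\<lambda>t. (T - t) * D t - \<phi> t) has_integral (T - T) * \<phi> T - (T - 0) * \<phi> 0) {0..T}"
    proof (rule fundamental_theorem_of_calculus)
      fix x
      have "((\<lambda>t. (T - t) * \<phi> t) has_real_derivative (T - x) * D x - \<phi> x) (at x)"
        using D(1) by (auto intro!: derivative_eq_intros)
      then show "((\<lambda>t. (T - t) * \<phi> t) has_vector_derivative (T - x) * D x - \<phi> x) (at x within {0..T})"
        by (simp add: has_real_derivative_iff_has_vector_derivative has_vector_derivative_at_within)
    qed (use assms in simp)
    then have "integral {0..T} (\<lambda>t. (T - t) * D t - \<phi> t) = 0"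
      using zero by (simp add: integral_unique)
    moreover have "(LINT t|?M. (T - t) * D t - \<phi> t) = integral {0..T} (\<lambda>t. (T - t) * D t - \<phi> t)"
      by (intro continuous_lebesgue_on_open_interval(2) continuous_on_diff continuous_on_mult c cD c\<phi>)
    moreover have "(LINT t|?M. (T - t) * D t - \<phi> t) = (LINT t|?M. (T - t) * D t) - (LINT t|?M. \<phi> t)"
      by (intro Bochner_Integration.integral_diff continuous_lebesgue_on_open_interval(1) continuous_on_mult c cD c\<phi>)
    ultimately show ?thesis by (simp add: L2_inner_def eq)
  qed
  then have "has_weak_derivative T (\<lambda>t. T - t) (\<lambda>_. - 1)"
    by (simp add: has_weak_derivative_def)
  then show ?thesis
    using c continuous_in_L2[OF c] L2_const unfolding H10_def H1_def by fastforce
qed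

section \<open>The dual space\<close>

lemma H10_normS_nonneg: "0 \<le> H10_normS T v"
  by (simp add: H10_normS_def normS_nonneg)

lemma H10S_in_L2S: "v \<in> H10S T \<Longrightarrow> v \<in> L2S T"
  by (auto simp: H10S_def L2S_def H10_in_L2)

lemma H10S_nontrivial:
  assumes "0 < T" shows "{v \<in> H10S T. \<not> eqS T v 0} \<noteq> {}"
proof -
  let ?v = "(\<lambda>t. T - t, \<lambda>t. T - t)"
  have "?v \<in> H10S T" using linear_in_H10[OF assms] by (simp add: H10S_def)
  moreover have "\<not> eqS T ?v 0" using assms by (intro not_eqS_0I) auto
  ultimately show ?thesis by blast
qed

text \<open>Cauchy-Schwarz leaves the \<open>L2S\<close> norm of the argument, which the Poincare
  inequality trades for \<open>H10_normS\<close> at the cost of a factor \<open>T\<close>.\<close>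

lemma embS_in_dualS:
  assumes "0 < T" and u: "u \<in> L2S T" shows "embS T u \<in> dualS T"
  unfolding dualS_def
proof (intro CollectI conjI ballI allI exI)
  show "embS T u (v + z) = embS T u v + embS T u z" if "v \<in> H10S T" "z \<in> H10S T" for v z
    using that u by (simp add: embS_def innerS_add_right H10S_in_L2S)
  show "embS T u (scaleS c v) = c * embS T u v" for c v
    by (simp add: embS_def innerS_scale_right)
  show "\<bar>embS T u v\<bar> \<le> normS T u * T * H10_normS T v" if v: "v \<in> H10S T" for v
    using innerS_Cauchy_Schwarz[OF u H10S_in_L2S[OF v]]
      mult_left_mono[OF normS_le_H10_normS[OF assms(1) v] normS_nonneg[of T u]]
    by (simp add: embS_def mult.assoc)
qed

lemma dualS_scale:
  assumes "F \<in> dualS T" shows "(\<lambda>v. c * F v) \<in> dualS T"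
proof -
  obtain C where "\<forall>u\<in>H10S T. \<bar>F u\<bar> \<le> C * H10_normS T u" using assms by (auto simp: dualS_def)
  then have "\<forall>u\<in>H10S T. \<bar>c * F u\<bar> \<le> (\<bar>c\<bar> * C) * H10_normS T u"
    by (simp add: abs_mult mult.assoc mult_left_mono)
  then have "\<exists>C. \<forall>u\<in>H10S T. \<bar>c * F u\<bar> \<le> C * H10_normS T u" by blast
  then show ?thesis using assms by (simp add: dualS_def distrib_left mult.left_commute)
qed

lemma dualS_add:
  assumes "F \<in> dualS T" "G \<in> dualS T" shows "F + G \<in> dualS T"
proof -
  obtain C D where "\<forall>u\<in>H10S T. \<bar>F u\<bar> \<le> C * H10_normS T u" "\<forall>u\<in>H10S T. \<bar>G u\<bar> \<le> D * H10_normS T u"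
    using assms by (auto simp: dualS_def)
  then have "\<forall>u\<in>H10S T. \<bar>(F + G) u\<bar> \<le> (C + D) * H10_normS T u"
    by (fastforce simp: distrib_right intro: order_trans[OF abs_triangle_ineq] add_mono)
  then have "\<exists>C. \<forall>u\<in>H10S T. \<bar>(F + G) u\<bar> \<le> C * H10_normS T u" by blast
  then show ?thesis using assms by (simp add: dualS_def distrib_left)
qed

text \<open>Brings differences into the shape in which \<open>single_layer_extension\<close> states
  additivity and homogeneity.\<close>

lemma diff_eq_add_scale: "F - G = F + (\<lambda>v. - 1 * G v)" for F G :: functional
  by (simp add: fun_eq_iff)

lemma dualS_diff: "F \<in> dualS T \<Longrightarrow> G \<in> dualS T \<Longrightarrow> F - G \<in> dualS T"
  by (subst diff_eq_add_scale) (intro dualS_add dualS_scale)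

text \<open>If \<open>H10_normS T v = 0\<close> then \<open>F v = 0\<close>, and the quotient has the harmless value \<open>0 / 0 = 0\<close>.\<close>

lemma dual_quotient_bdd:
  assumes "F \<in> dualS T"
  shows "bdd_above ((\<lambda>v. F v / H10_normS T v) ` {v \<in> H10S T. \<not> eqS T v 0})"
proof -
  obtain C where C: "\<forall>u\<in>H10S T. \<bar>F u\<bar> \<le> C * H10_normS T u" using assms by (auto simp: dualS_def)
  \<comment> \<open>\<open>\<bar>C\<bar>\<close> instead of \<open>C\<close> also dominates the
    quotient 0 that arises from a vanishing norm.\<close>
  have "F v / H10_normS T v \<le> \<bar>C\<bar>" if "v \<in> H10S T" for v
  proof (cases "H10_normS T v = 0")
    case False
    then have "0 < H10_normS T v" using H10_normS_nonneg[of T v] by simp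
    moreover have "F v \<le> \<bar>C\<bar> * H10_normS T v"
      using C that H10_normS_nonneg[of T v] mult_right_mono[OF abs_ge_self[of C], of "H10_normS T v"]
      by fastforce
    ultimately show ?thesis by (simp add: divide_le_eq)
  qed simp
  then show ?thesis by (auto intro!: bdd_aboveI)
qed

text \<open>The decomposition is required on \<open>H10S\<close> only, since additivity of
  \<open>embS\<close> relies on integrability of the products.\<close>

lemma dual_normS_triangle:
  assumes "0 < T" "F \<in> dualS T" "G \<in> dualS T" "\<And>v. v \<in> H10S T \<Longrightarrow> E v = F v + G v"
  shows "dual_normS T E \<le> dual_normS T F + dual_normS T G"
  unfolding dual_normS_def[of T E]
proof (rule cSUP_least[OF H10S_nontrivial[OF assms(1)]])
  fix v assume v: "v \<in> {v \<in> H10S T. \<not> eqS T v 0}"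
  then have "E v / H10_normS T v = F v / H10_normS T v + G v / H10_normS T v"
    using assms(4) by (simp add: add_divide_distrib)
  also have "\<dots> \<le> dual_normS T F + dual_normS T G"
    unfolding dual_normS_def using v assms(2,3)
    by (intro add_mono cSUP_upper dual_quotient_bdd) auto
  finally show "E v / H10_normS T v \<le> dual_normS T F + dual_normS T G" .
qed

section \<open>The single layer operator and the boundary element spaces\<close>

lemma L2_set_integrable:
  assumes "f \<in> L2 T" "t \<le> T" shows "set_integrable lebesgue {0<..<t} f"
proof -
  have "set_integrable lebesgue {0<..<T} f"
    using L2_integrable[OF assms(1)] by (simp add: set_integrable_def integrable_restrict_space)
  then show ?thesis by (rule set_integrable_subset) (use assms(2) in auto)
qed

text \<open>For \<open>t\<close> in (0,T) both upper limits \<open>t\<close> and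
  \<open>t - L\<close> are at most \<open>T\<close>, so all integrals exist and are linear; beyond
  \<open>T\<close> the representatives are uncontrolled, hence \<open>eqS\<close>.\<close>

lemma single_layer_diff:
  assumes "0 < L" "u \<in> L2S T" "v \<in> L2S T"
  shows "eqS T (single_layer L (u - v)) (single_layer L u - single_layer L v)"
proof -
  have diff: "(LINT s:{0<..<t}|lebesgue. (f - k) s)
      = (LINT s:{0<..<t}|lebesgue. f s) - (LINT s:{0<..<t}|lebesgue. k s)"
    if "f \<in> L2 T" "k \<in> L2 T" "t \<le> T" for f k t
    unfolding minus_apply using that by (intro set_integral_diff(2) L2_set_integrable)
  have L2s: "fst u \<in> L2 T" "snd u \<in> L2 T" "fst v \<in> L2 T" "snd v \<in> L2 T"
    using assms by (auto simp: L2S_def)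
  show ?thesis
    unfolding eqS_def single_layer_def
    by (intro conjI AE_I2) (use L2s assms(1) in \<open>simp_all add: diff field_simps\<close>)
qed

lemma S0_in_L2S: "u \<in> S0 T M \<Longrightarrow> u \<in> L2S T"
  by (simp add: S0_def)

lemma S0_diff:
  assumes "u \<in> S0 T M" "v \<in> S0 T M" shows "u - v \<in> S0 T M"
proof -
  have AE_diff: "\<exists>c. AE t in lebesgue_on {a<..<b}. (f - k) t = c"
    if const: "\<exists>c. AE t in lebesgue_on {a<..<b}. f t = c" "\<exists>c. AE t in lebesgue_on {a<..<b}. k t = c"
    for a b :: real and f k :: "real \<Rightarrow> real"
  proof -
    obtain c d where "AE t in lebesgue_on {a<..<b}. f t = c" "AE t in lebesgue_on {a<..<b}. k t = d"
      using const by blast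
    then have "AE t in lebesgue_on {a<..<b}. (f - k) t = c - d" by eventually_elim simp
    then show ?thesis by blast
  qed
  have "\<exists>c. AE t in lebesgue_on {a<..<b}. fst (u - v) t = c" if "(a, b) \<in> elements (fst M)" for a b
    unfolding fst_diff using that assms by (intro AE_diff) (auto simp: S0_def)
  moreover have "\<exists>c. AE t in lebesgue_on {a<..<b}. snd (u - v) t = c" if "(a, b) \<in> elements (snd M)" for a b
    unfolding snd_diff using that assms by (intro AE_diff) (auto simp: S0_def)
  ultimately show ?thesis
    using L2S_diff[OF S0_in_L2S S0_in_L2S, OF assms] unfolding S0_def by blast
qed

lemma S0_nontrivial:
  assumes "0 < T" shows "{q \<in> S0 T M. \<not> eqS T q 0} \<noteq> {}"
proof -
  let ?q = "(\<lambda>_. 1, \<lambda>_. 1) :: bfun"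
  have "?q \<in> S0 T M" by (auto simp: S0_def L2S_def L2_const)
  moreover have "\<not> eqS T ?q 0" using assms by (intro not_eqS_0I) auto
  ultimately show ?thesis by blast
qed

text \<open>Allows \<open>f\<close> and \<open>k\<close> to be explicit representatives, such as the
  datum or a single layer integral, in place of the values of \<open>V\<close>.\<close>

lemma extension_diff:
  assumes "single_layer_extension L T V" "F \<in> dualS T" "G \<in> dualS T"
    and "eqS T (V F) f" "eqS T (V G) k"
  shows "eqS T (V (F - G)) (f - k)"
proof (rule eqS_diff_add_scale)
  show "eqS T (V (F - G)) (V F + V (\<lambda>v. - 1 * G v))"
    unfolding diff_eq_add_scale[of F G]
    using assms dualS_scale[OF assms(3)] unfolding single_layer_extension_def by blast
  show "eqS T (V (\<lambda>v. - 1 * G v)) (scaleS (- 1) (V G))"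
    using assms unfolding single_layer_extension_def by blast
qed (rule assms)+

text \<open>No estimate of the integrals is made: the function agrees almost everywhere with a value
  of \<open>V\<close>, which lies in \<open>L2S\<close>.\<close>

lemma single_layer_in_L2S:
  assumes "0 < T" "single_layer_extension L T V" "u \<in> L2S T"
  shows "single_layer L u \<in> L2S T"
  using assms embS_in_dualS[OF assms(1,3)] L2S_cong unfolding single_layer_extension_def by blast

section \<open>Two-sided error bound by the residual \<open>ph\<close>\<close>

theorem lemma3p4:
  fixes L T h Hf H c2 cS \<delta> :: real
    and Mh MHf MH :: mesh
    and V :: "functional \<Rightarrow> bfun"
    and g ph wH pbar wHf :: bfun
    and w :: functional
  assumes "0 < L" and "0 < T"
    and "single_layer_extension L T V"
    and "0 < c2"
    and "\<forall>v\<in>dualS T. normS T (V v) \<le> c2 * dual_normS T v"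
    and "is_mesh T Mh" and "is_mesh T MHf" and "is_mesh T MH"
    and "h = mesh_size Mh" and "Hf = mesh_size MHf" and "H = mesh_size MH"
    and "0 < h" and "h < Hf" and "Hf < H"
    and "mesh_refines MHf MH" and "mesh_refines Mh MHf"
    and "S0 T MH \<subseteq> S0 T MHf" and "S0 T MHf \<subseteq> S0 T Mh"
    and "0 < cS"
    and "\<forall>v\<in>S0 T MHf. cS * dual_normS T (embS T v)
           \<le> (SUP q \<in> {q \<in> S0 T Mh. \<not> eqS T q 0}. innerS T (single_layer L v) q / normS T q)"
    and "g \<in> L2S T"
    and "w \<in> dualS T" and "eqS T (V w) g"
    and "ph \<in> S0 T Mh" and "wH \<in> S0 T MH"
    and "\<forall>q\<in>S0 T Mh. innerS T ph q + innerS T (single_layer L wH) q = innerS T g q"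
    and "\<forall>v\<in>S0 T MH. innerS T ph (single_layer L v) = 0"
    and "pbar \<in> S0 T Mh" and "wHf \<in> S0 T MHf"
    and "\<forall>q\<in>S0 T Mh. innerS T pbar q + innerS T (single_layer L wHf) q = innerS T g q"
    and "\<forall>v\<in>S0 T MHf. innerS T pbar (single_layer L v) = 0"
    and "0 < \<delta>" and "\<delta> < 1"
    and "dual_normS T (w - embS T wHf) \<le> \<delta> * dual_normS T (w - embS T wH)"
  shows "1 / c2 * normS T ph \<le> dual_normS T (w - embS T wH) \<and>
         dual_normS T (w - embS T wH) \<le> c2 / cS\<^sup>2 * (1 / (1 - \<delta>)) * normS T ph"
proof
  note V = assms(3)
  let ?F = "w - embS T wH"
  have sub: "S0 T MH \<subseteq> S0 T MHf" by (rule assms(17))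
  have L2s: "ph \<in> L2S T" "pbar \<in> L2S T" "wH \<in> L2S T" "wHf \<in> L2S T"
    using assms S0_in_L2S by blast+
  have dual: "embS T wH \<in> dualS T" "embS T wHf \<in> dualS T"
    using embS_in_dualS assms(2) L2s by blast+
  have layer: "single_layer L u \<in> L2S T" if "u \<in> L2S T" for u
    by (rule single_layer_in_L2S[OF assms(2) V that])
  have "eqS T (V ?F) (g - single_layer L wH)"
    using V L2s dual assms(22,23)
    by (intro extension_diff[OF V]) (auto simp: single_layer_extension_def)
  moreover have "V ?F \<in> L2S T" using V dualS_diff[OF assms(22) dual(1)] by (simp add: single_layer_extension_def)
  ultimately have "innerS T (V ?F) ph = innerS T (g - single_layer L wH) ph"
    using L2s by (intro innerS_cong)
  \<comment> \<open>The first Galerkin equation on the coarse level, tested with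
    \<open>q = ph\<close>.\<close>
  also have "\<dots> = (normS T ph)\<^sup>2"
    using assms(21,24,26) L2s layer by (simp add: innerS_diff_left normS_power2) (smt (verit))
  finally have "(normS T ph)\<^sup>2 \<le> normS T (V ?F) * normS T ph"
    using innerS_Cauchy_Schwarz[OF \<open>V ?F \<in> L2S T\<close> L2s(1)] by simp
  then have "normS T ph \<le> normS T (V ?F)"
    using normS_nonneg[of T ph] normS_nonneg[of T "V ?F"]
    by (cases "normS T ph = 0") (auto simp: power2_eq_square)
  also have "\<dots> \<le> c2 * dual_normS T ?F" using assms(5) dualS_diff[OF assms(22) dual(1)] by blast
  finally show "1 / c2 * normS T ph \<le> dual_normS T ?F"
    using assms(4) by (simp add: divide_le_eq mult.commute)

  \<comment> \<open>The upper bound starts here, with the differences of the two discrete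
    solutions.\<close>
  define e where "e = wHf - wH"
  define d where "d = ph - pbar"
  have e: "e \<in> S0 T MHf" using assms(25,29) sub unfolding e_def by (intro S0_diff) auto
  have d: "d \<in> S0 T Mh" using assms(24,28) unfolding d_def by (intro S0_diff) auto
  have eL2: "e \<in> L2S T" and dL2: "d \<in> L2S T" using e d S0_in_L2S by auto
  have e_dual: "embS T e \<in> dualS T" using embS_in_dualS assms(2) eL2 by blast
  \<comment> \<open>Linearity of \<open>single_layer\<close> holds up to null sets only, so it is
    used inside inner products.\<close>
  have inner_e: "innerS T (single_layer L e) q
      = innerS T (single_layer L wHf) q - innerS T (single_layer L wH) q" if "q \<in> L2S T" for q
    using innerS_cong[OF layer[OF eL2] that] single_layer_diff[OF assms(1) L2s(4,3)] layer L2s that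
    by (simp add: e_def innerS_diff_left)
  \<comment> \<open>The first Galerkin equations of the two levels share test space and datum;
    subtracting them eliminates \<open>g\<close>.\<close>
  have galerkin: "innerS T (single_layer L e) q = innerS T d q" if "q \<in> S0 T Mh" for q
    using assms(26)[rule_format, OF that] assms(30)[rule_format, OF that] S0_in_L2S[OF that] L2s
    by (simp add: inner_e d_def innerS_diff_left)
  have "cS * dual_normS T (embS T e) \<le>
      (SUP q \<in> {q \<in> S0 T Mh. \<not> eqS T q 0}. innerS T (single_layer L e) q / normS T q)"
    using assms(20) e by blast
  also have "\<dots> \<le> normS T d"
  proof (rule cSUP_least[OF S0_nontrivial[OF assms(2)]])
    fix q assume "q \<in> {q \<in> S0 T Mh. \<not> eqS T q 0}"
    then have q: "q \<in> S0 T Mh" by simp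
    have "innerS T d q \<le> normS T d * normS T q"
      using innerS_Cauchy_Schwarz[OF dL2 S0_in_L2S[OF q]] by simp
    then show "innerS T (single_layer L e) q / normS T q \<le> normS T d"
      using normS_nonneg[of T d] normS_nonneg[of T q] galerkin[OF q]
      \<comment> \<open>A vanishing norm gives the quotient 0, as division by zero yields 0.\<close>
      by (cases "normS T q = 0") (auto simp: divide_le_eq)
  qed
  finally have inf_sup: "cS * dual_normS T (embS T e) \<le> normS T d" .
  \<comment> \<open>By nestedness \<open>wH\<close> also lies in the finer trial space, so the
    second equation for \<open>pbar\<close> applies to both parts of \<open>e\<close>.\<close>
  have "innerS T (single_layer L e) pbar = 0"
    using assms(31) assms(29) subsetD[OF sub assms(25)]
    by (simp add: inner_e[OF L2s(2)] innerS_commute[of T "single_layer L wHf" pbar]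
        innerS_commute[of T "single_layer L wH" pbar])
  then have "(normS T d)\<^sup>2 = innerS T (single_layer L e) ph"
    using galerkin[OF d] L2s layer[OF eL2] by (simp add: normS_power2 d_def innerS_diff_right)
  \<comment> \<open>Passing to \<open>V\<close> makes the bound \<open>c2\<close> in the dual norm
    applicable.\<close>
  also have "\<dots> = innerS T (V (embS T e)) ph"
    using V e_dual eL2 L2s(1) by (intro innerS_cong[symmetric]) (auto simp: single_layer_extension_def)
  also have "\<dots> \<le> normS T (V (embS T e)) * normS T ph"
    using innerS_Cauchy_Schwarz[of "V (embS T e)" T ph] V e_dual L2s(1)
    by (simp add: single_layer_extension_def)
  also have "\<dots> \<le> c2 * dual_normS T (embS T e) * normS T ph"
    using assms(5) e_dual normS_nonneg by (intro mult_right_mono) auto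
  finally have norm_d: "(normS T d)\<^sup>2 \<le> c2 * dual_normS T (embS T e) * normS T ph" .
  \<comment> \<open>Combining \<open>inf_sup\<close>, squared, with \<open>norm_d\<close> and
    cancelling one dual norm needs that norm to be positive; otherwise the claim follows from a
    nonnegative right-hand side.\<close>
  have bound: "dual_normS T (embS T e) \<le> c2 / cS\<^sup>2 * normS T ph"
  proof (cases "0 < dual_normS T (embS T e)")
    case True
    have "(cS * dual_normS T (embS T e))\<^sup>2 \<le> (normS T d)\<^sup>2"
      using inf_sup True assms(19) by (intro power_mono) auto
    then have "cS\<^sup>2 * dual_normS T (embS T e) * dual_normS T (embS T e)
        \<le> c2 * normS T ph * dual_normS T (embS T e)"
      using norm_d by (simp add: power2_eq_square algebra_simps)
    then have "cS\<^sup>2 * dual_normS T (embS T e) \<le> c2 * normS T ph" using True by simp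
    then show ?thesis using assms(19) by (simp add: field_simps)
  next
    case False
    moreover have "0 \<le> c2 / cS\<^sup>2 * normS T ph" using assms(4) normS_nonneg[of T ph] by simp
    ultimately show ?thesis by linarith
  qed
  have "dual_normS T ?F \<le> dual_normS T (w - embS T wHf) + dual_normS T (embS T e)"
    by (rule dual_normS_triangle[OF assms(2) dualS_diff[OF assms(22) dual(2)] e_dual])
      (simp add: embS_def e_def innerS_diff_left L2s H10S_in_L2S)
  \<comment> \<open>Saturation bounds the fine error by \<delta> times the coarse one, which is
    absorbed on the left.\<close>
  then have "(1 - \<delta>) * dual_normS T ?F \<le> c2 / cS\<^sup>2 * normS T ph"
    using assms(34) bound by (simp add: algebra_simps)
  then have "dual_normS T ?F \<le> c2 / cS\<^sup>2 * normS T ph / (1 - \<delta>)"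
    using assms(33) by (subst pos_le_divide_eq) (simp_all add: mult.commute[of "1 - \<delta>"])
  then show "dual_normS T ?F \<le> c2 / cS\<^sup>2 * (1 / (1 - \<delta>)) * normS T ph" by simp
qed

end
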